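(* Let $m\ge 3$ and $n\ge 1$ be integers, let $C_m$ be the cycle with $m$ vertices, and let $\mathbf{G}:=C_m^n$ be the $n$-dimensional discrete torus with side length $m$. For every nonempty $A\subseteq V(\mathbf{G})$, $$e_{\mathbf{G}}(A,A^c)\ge\begin{cases}2n\cdot|A|^{1-1/n}&\text{if }|A|\le(m/e)^n,\\[2pt] \dfrac{|A|}{m}\cdot 2e\log\dfrac{m^n}{|A|}&\text{if }|A|\ge(m/e)^n.\end{cases}$$ Here $e$ without a subscript is Euler's number.
   Context: $\log$ is the natural logarithm. For a graph $G$ and $A\subseteq V(G)$, $A^c=V(G)\setminus A$ and $e_G(A,A^c)$ is the number of edges of $G$ with exactly one endpoint in $A$. $G^n$ denotes the product graph $G\square\cdots\square G$ ($n$ copies): its vertex set is $V(G)^n$ and its edges are all pairs $\{u,v\}$ for which there is an index $j\in\{1,\dots,n\}$ such that $u_jv_j\in E(G)$ and $u_l=v_l$ for all $l\neq j$. *)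

theory Defs
  imports Complex_Main "HOL-Library.FuncSet"
begin

text \<open>Finite simple graphs: an edge is the two-element set of its endpoints.\<close>

record 'a ugraph =
  vertices :: "'a set"
  edges :: "'a set set"

definition cycle_graph :: "nat \<Rightarrow> nat ugraph" where
  "cycle_graph m =
    \<lparr> vertices = {0..<m},
      edges = {{i, (i + 1) mod m} | i. i < m} \<rparr>"

text \<open>
  An \<open>n\<close>-tuple of vertices is an extensional function on \<open>{1..n}\<close>, so that distinct functions
  in the vertex set represent distinct tuples.
\<close>

definition graph_power :: "'a ugraph \<Rightarrow> nat \<Rightarrow> (nat \<Rightarrow> 'a) ugraph" where
  "graph_power G n =
    \<lparr> vertices = {1..n} \<rightarrow>\<^sub>E vertices G,
      edges = {{u, v} | u v.
        u \<in> {1..n} \<rightarrow>\<^sub>E vertices G \<and> v \<in> {1..n} \<rightarrow>\<^sub>E vertices G \<and>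
        (\<exists>j\<in>{1..n}. {u j, v j} \<in> edges G \<and> (\<forall>l\<in>{1..n} - {j}. u l = v l))} \<rparr>"

text \<open>The number of edges with exactly one endpoint in \<open>A\<close>, i.e. \<open>e\<^sub>G(A, A\<^sup>c)\<close>.\<close>

definition edge_boundary_size :: "'a ugraph \<Rightarrow> 'a set \<Rightarrow> nat" where
  "edge_boundary_size G A = card {f \<in> edges G. \<exists>!x. x \<in> f \<and> x \<in> A}"

end

theory Submission
  imports Defs
begin

text \<open>
  For \<open>x \<in> A\<close> let \<open>k\<^sub>i(x)\<close> be the number of points of \<open>A\<close> on the line through \<open>x\<close> in direction \<open>i\<close>.
  A line that meets \<open>A\<close> but is not contained in it carries at least two boundary edges, so the
  edge boundary is at least \<open>\<Sum>x\<in>A. \<Sum>i. 2/k\<^sub>i(x)\<close>, restricted to \<open>k\<^sub>i(x) < m\<close>. Han's inequality for the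
  uniform distribution on \<open>A\<close> says that \<open>\<Sum>x\<in>A. \<Sum>i. ln k\<^sub>i(x) \<le> |A| ln |A|\<close>. Jensen's inequality, used
  through tangent lines to \<open>exp\<close> at a point \<open>c \<ge> 1\<close>, combines the two; with \<open>L = ln (m^n/|A|)\<close> the
  choices \<open>c = L/n\<close> and \<open>c = 1\<close> give the two cases.
\<close>

section \<open>Lines in a coordinate direction and Han's inequality\<close>

text \<open>The part of \<open>A\<close> on the axis-parallel line through \<open>x\<close>.
  Agreement is asked on the whole index type; extensional tuples agree outside \<open>{1..n}\<close>
  anyway.\<close>

definition fibre :: "('i \<Rightarrow> 'a) set \<Rightarrow> 'i \<Rightarrow> ('i \<Rightarrow> 'a) \<Rightarrow> ('i \<Rightarrow> 'a) set" where
  "fibre A i x = {y \<in> A. \<forall>l. l \<noteq> i \<longrightarrow> y l = x l}"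

lemma fibre_eq: "u \<in> fibre A i x \<Longrightarrow> fibre A i u = fibre A i x"
  by (auto simp: fibre_def)

lemma fibre_sym: "x \<in> A \<Longrightarrow> u \<in> A \<Longrightarrow> u \<in> fibre A i x \<longleftrightarrow> x \<in> fibre A i u"
  by (auto simp: fibre_def)

lemma finite_fibre: "finite A \<Longrightarrow> finite (fibre A i x)"
  by (simp add: fibre_def)

lemma card_fibre_pos:
  assumes "finite A" "x \<in> A"
  shows "card (fibre A i x) > 0"
  using assms by (auto simp: fibre_def card_gt_0_iff)

text \<open>In a triple \<open>(x, y, z)\<close> counted on the left, \<open>x\<close> can be
  recovered from \<open>(y, z)\<close>: coordinate \<open>j\<close> is that of \<open>z\<close>, all
  others are those of \<open>y\<close>.\<close>

lemma sum_card_fibre_mult_card_slice_le: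
  assumes "finite A"
  shows "(\<Sum>x\<in>A. card (fibre A j x) * card {z\<in>A. z j = x j}) \<le> card A * card A"
proof -
  let ?S = "SIGMA x:A. fibre A j x \<times> {z\<in>A. z j = x j}"
  have "(\<Sum>x\<in>A. card (fibre A j x) * card {z\<in>A. z j = x j}) = card ?S"
    using assms by (simp add: finite_fibre card_SigmaI card_cartesian_product)
  also have "\<dots> \<le> card (A \<times> A)"
  proof (rule card_inj_on_le)
    show "inj_on snd ?S"
    proof (rule inj_onI)
      fix p q assume p: "p \<in> ?S" and q: "q \<in> ?S" and eq: "snd p = snd q"
      obtain x y z where pe: "p = (x, y, z)" by (cases p)
      obtain x' where qe: "q = (x', y, z)" using eq pe by (cases q) auto
      have "x l = x' l" for l
        using p q unfolding pe qe by (cases "l = j") (auto simp: fibre_def)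
      then show "p = q" using pe qe by auto
    qed
    show "snd ` ?S \<subseteq> A \<times> A" by (auto simp: fibre_def)
    show "finite (A \<times> A)" using assms by simp
  qed
  finally show ?thesis by (simp add: card_cartesian_product)
qed

text \<open>Cut \<open>A\<close> into slices by the value of coordinate \<open>j\<close>. The other
  directions are handled inside each slice by induction; direction \<open>j\<close> follows from the
  preceding count.\<close>

theorem sum_ln_card_fibre_le:
  assumes "finite I" "finite A"
  shows "(\<Sum>x\<in>A. \<Sum>i\<in>I. ln (real (card (fibre A i x)))) \<le> real (card A) * ln (real (card A))"
  using assms
proof (induction I arbitrary: A rule: finite_induct)
  case empty
  show ?case by (cases "card A") (simp_all add: mult_nonneg_nonneg)
next
  case (insert j I)
  define S where "S t = {z\<in>A. z j = t}" for t
  have finS: "finite (S t)" for t using insert.prems by (simp add: S_def)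
  show ?case
  proof (cases "A = {}")
    case False
    define a where "a = real (card A)"
    have a: "a > 0" using False insert.prems by (simp add: a_def card_gt_0_iff)
    \<comment> \<open>Moving in a direction \<open>i\<close> other than \<open>j\<close> does not
      leave the slice.\<close>
    have fib: "fibre A i x = fibre (S (x j)) i x" if "i \<in> I" for i x
      using that insert.hyps by (auto simp: fibre_def S_def)
    have split: "(\<Sum>x\<in>A. f x) = (\<Sum>t\<in>(\<lambda>x. x j) ` A. \<Sum>x\<in>S t. f x)" for f :: "_ \<Rightarrow> real"
      unfolding S_def by (rule sum.image_gen[OF insert.prems])
    have "(\<Sum>x\<in>A. \<Sum>i\<in>I. ln (real (card (fibre A i x))))
        = (\<Sum>t\<in>(\<lambda>x. x j) ` A. \<Sum>x\<in>S t. \<Sum>i\<in>I. ln (real (card (fibre (S t) i x))))"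
      unfolding split by (intro sum.cong refl) (simp add: fib, simp add: S_def)
    also have "\<dots> \<le> (\<Sum>t\<in>(\<lambda>x. x j) ` A. real (card (S t)) * ln (real (card (S t))))"
      by (intro sum_mono insert.IH finS)
    also have "\<dots> = (\<Sum>x\<in>A. ln (real (card (S (x j)))))"
      unfolding split by (intro sum.cong refl) (simp add: S_def)
    finally have IH: "(\<Sum>x\<in>A. \<Sum>i\<in>I. ln (real (card (fibre A i x))))
        \<le> (\<Sum>x\<in>A. ln (real (card (S (x j)))))" .
    \<comment> \<open>Use \<open>ln t \<le> t - 1\<close>, where \<open>t\<close> is the fibre size
      times the slice size over \<open>a\<close>; the count shows that \<open>t\<close> averages to
      at most 1 over \<open>A\<close>.\<close>
    have "ln (real (card (fibre A j x))) + ln (real (card (S (x j)))) - ln a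
        \<le> real (card (fibre A j x) * card (S (x j))) / a - 1" if "x \<in> A" for x
    proof -
      have p: "card (fibre A j x) > 0" "card (S (x j)) > 0"
        using card_fibre_pos[OF insert.prems that] finS[of "x j"] that
        by (auto simp: card_gt_0_iff S_def)
      then have "ln (real (card (fibre A j x))) + ln (real (card (S (x j)))) - ln a
          = ln (real (card (fibre A j x) * card (S (x j))) / a)"
        using a by (simp add: ln_div ln_mult)
      also have "\<dots> \<le> real (card (fibre A j x) * card (S (x j))) / a - 1"
        using p a by (intro ln_le_minus_one) simp
      finally show ?thesis .
    qed
    then have "(\<Sum>x\<in>A. ln (real (card (fibre A j x))) + ln (real (card (S (x j)))) - ln a)
        \<le> (\<Sum>x\<in>A. real (card (fibre A j x) * card (S (x j))) / a - 1)"
      by (rule sum_mono)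
    also have "\<dots> = real (\<Sum>x\<in>A. card (fibre A j x) * card (S (x j))) / a - a"
      by (simp add: sum_subtractf sum_divide_distrib a_def)
    also have "\<dots> \<le> a * a / a - a"
      using sum_card_fibre_mult_card_slice_le[OF insert.prems, of j] a
      unfolding a_def S_def of_nat_mult[symmetric]
      by (intro diff_right_mono divide_right_mono of_nat_mono) auto
    also have "\<dots> = 0" by simp
    finally have "(\<Sum>x\<in>A. ln (real (card (fibre A j x)))) + (\<Sum>x\<in>A. ln (real (card (S (x j))))) - a * ln a \<le> 0"
      by (simp add: sum.distrib sum_subtractf a_def)
    with IH show ?thesis
      using insert.hyps by (simp add: sum.distrib a_def)
  qed simp
qed

section \<open>Boundary edges along a line\<close>

lemma mod_add_eq_if:
  fixes a s m :: nat
  assumes "a < m" "s < m"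
  shows "(a + s) mod m = (if a + s < m then a + s else a + s - m)"
  using assms by (auto simp: mod_if)

text \<open>Adding \<open>1\<close> and adding \<open>m - 1\<close> modulo \<open>m\<close> are the two directions around the cycle.\<close>

lemma ex_multiple_step:
  fixes a b m s :: nat
  assumes "a < m" "b < m" "s \<in> {1, m - 1}"
  shows "\<exists>k. (a + k * s) mod m = b"
proof (cases "s = 1")
  case True
  then show ?thesis using assms by (intro exI[of _ "m - a + b"]) simp
next
  case False
  then have s: "s = m - 1" using assms by simp
  obtain d where d: "m = Suc (b + d)"
    using assms(2) less_iff_Suc_add by auto
  \<comment> \<open>A step by \<open>m - 1\<close> is a step by -1, and
    \<open>Suc d = m - b\<close>, so \<open>a + Suc d\<close> such steps lead from \<open>a\<close>
    to \<open>b - m\<close>.\<close>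
  then have "a + (a + Suc d) * s = (a + d) * m + b"
    using s by (simp add: algebra_simps)
  then show ?thesis using assms(2) by (intro exI[of _ "a + Suc d"]) simp
qed

text \<open>If no step left \<open>A\<close>, the walk from \<open>x\<close> with step
  \<open>s\<close> would stay in \<open>A\<close> and visit all \<open>m\<close> points of the
  line.\<close>

lemma ex_exit_in_fibre:
  fixes A :: "('i \<Rightarrow> nat) set"
  assumes bnd: "\<And>y. y \<in> A \<Longrightarrow> y i < m" and x: "x \<in> A" and s: "s \<in> {1, m - 1}"
    and less: "card (fibre A i x) < m"
  shows "\<exists>u\<in>fibre A i x. u(i := (u i + s) mod m) \<notin> A"
proof (rule ccontr)
  assume "\<not> ?thesis"
  then have closed: "u(i := (u i + s) mod m) \<in> A" if "u \<in> fibre A i x" for u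
    using that by blast
  have xm: "x i < m" using bnd x by blast
  have walk: "x(i := (x i + k * s) mod m) \<in> fibre A i x" for k
  proof (induction k)
    case 0
    then show ?case using x xm by (simp add: fibre_def)
  next
    case (Suc k)
    have "((x i + k * s) mod m + s) mod m = (x i + Suc k * s) mod m"
      by (simp add: mod_simps algebra_simps)
    with closed[OF Suc] have "x(i := (x i + Suc k * s) mod m) \<in> A"
      by (simp only: fun_upd_upd fun_upd_same)
    then show ?case by (auto simp: fibre_def fun_upd_def)
  qed
  have "(\<lambda>t. x(i := t)) ` {..<m} \<subseteq> fibre A i x"
    using walk ex_multiple_step[OF xm _ s] by blast
  moreover have "finite (fibre A i x)"
  proof (rule finite_subset)
    show "fibre A i x \<subseteq> (\<lambda>t. x(i := t)) ` {..<m}"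
    proof
      fix y assume y: "y \<in> fibre A i x"
      then have "y = x(i := y i)" by (auto simp: fibre_def)
      with y bnd show "y \<in> (\<lambda>t. x(i := t)) ` {..<m}" by (auto simp: fibre_def)
    qed
  qed simp
  ultimately have "card ((\<lambda>t. x(i := t)) ` {..<m}) \<le> card (fibre A i x)"
    by (rule card_mono[rotated])
  moreover have "inj_on (\<lambda>t. x(i := t)) {..<m}"
    by (metis fun_upd_same inj_onI)
  ultimately show False using less by (simp add: card_image)
qed

text \<open>On each line that meets \<open>A\<close>, the weights \<open>1 / k\<close> of its points
  in \<open>A\<close> add up to 1, and a line with fewer than \<open>m\<close> such points has an
  exit to charge this to.\<close>

lemma sum_inverse_card_fibre_le_exits:
  fixes A :: "('i \<Rightarrow> nat) set"
  assumes fin: "finite A" and bnd: "\<And>y. y \<in> A \<Longrightarrow> y i < m" and s: "s \<in> {1, m - 1}"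
  shows "(\<Sum>x\<in>A. if card (fibre A i x) < m then 1 / real (card (fibre A i x)) else 0)
    \<le> real (card {u\<in>A. u(i := (u i + s) mod m) \<notin> A})"
proof -
  define D where "D = {u\<in>A. u(i := (u i + s) mod m) \<notin> A}"
  let ?w = "\<lambda>x. 1 / real (card (fibre A i x))"
  have finD: "finite D" using fin by (simp add: D_def)
  have "(\<Sum>x\<in>A. if card (fibre A i x) < m then ?w x else 0)
      \<le> (\<Sum>x\<in>A. \<Sum>u\<in>D. if u \<in> fibre A i x then ?w x else 0)"
  proof (rule sum_mono)
    fix x assume x: "x \<in> A"
    show "(if card (fibre A i x) < m then ?w x else 0)
      \<le> (\<Sum>u\<in>D. if u \<in> fibre A i x then ?w x else 0)"
    proof (cases "card (fibre A i x) < m")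
      case True
      then obtain u where u: "u \<in> fibre A i x" "u \<in> D"
        using ex_exit_in_fibre[of A i m x s] bnd x s by (auto simp: D_def fibre_def)
      have "(if u \<in> fibre A i x then ?w x else 0)
          \<le> (\<Sum>u\<in>D. if u \<in> fibre A i x then ?w x else 0)"
        using u finD by (intro member_le_sum) auto
      then show ?thesis using u True by simp
    qed (auto intro: sum_nonneg)
  qed
  also have "\<dots> = (\<Sum>u\<in>D. \<Sum>x\<in>A. if u \<in> fibre A i x then ?w x else 0)"
    by (rule sum.swap)
  \<comment> \<open>Points on a common line have the same fibre, so the weight at \<open>x\<close>
    may be read off at \<open>u\<close>.\<close>
  also have "\<dots> = (\<Sum>u\<in>D. \<Sum>x\<in>A. if x \<in> fibre A i u then ?w u else 0)"
    by (intro sum.cong refl if_cong) (auto simp: D_def fibre_sym fibre_eq)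
  also have "\<dots> = (\<Sum>u\<in>D. \<Sum>x\<in>fibre A i u. ?w u)"
    by (intro sum.cong refl sum.mono_neutral_cong_right fin) (auto simp: fibre_def)
  also have "\<dots> = (\<Sum>u\<in>D. 1)"
    using card_fibre_pos[OF fin] by (intro sum.cong refl) (fastforce simp: D_def)
  finally show ?thesis by (simp add: D_def)
qed

text \<open>A boundary edge determines its exit: \<open>u\<close> is the only endpoint in
  \<open>A\<close>, \<open>i\<close> is the coordinate that changes, and \<open>s\<close> is the
  change modulo \<open>m\<close>.\<close>

lemma sum_card_exits_le_edge_boundary_size:
  assumes m: "m \<ge> 3" and A: "A \<subseteq> vertices (graph_power (cycle_graph m) n)"
  shows "(\<Sum>i\<in>{1..n}. \<Sum>s\<in>{1, m - 1}. card {u\<in>A. u(i := (u i + s) mod m) \<notin> A})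
    \<le> edge_boundary_size (graph_power (cycle_graph m) n) A"
proof -
  let ?G = "graph_power (cycle_graph m) n"
  let ?v = "\<lambda>i s (u :: nat \<Rightarrow> nat). u(i := (u i + s) mod m)"
  let ?B = "SIGMA i:{1..n}. SIGMA s:{1, m - 1}. {u\<in>A. ?v i s u \<notin> A}"
  let ?f = "\<lambda>(i, s, u). {u, ?v i s u}"
  have V: "A \<subseteq> {1..n} \<rightarrow>\<^sub>E {0..<m}"
    using A by (simp add: graph_power_def cycle_graph_def)
  then have finA: "finite A"
    by (rule finite_subset) (auto intro: finite_PiE)
  have less: "u i < m" if "u \<in> A" "i \<in> {1..n}" for u i
    using that V by fastforce
  have "(\<Sum>i\<in>{1..n}. \<Sum>s\<in>{1, m - 1}. card {u\<in>A. ?v i s u \<notin> A}) = card ?B"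
    using finA by (simp add: card_SigmaI)
  also have "\<dots> \<le> card {f \<in> edges ?G. \<exists>!x. x \<in> f \<and> x \<in> A}"
  proof (rule card_inj_on_le)
    show "inj_on ?f ?B"
    proof (rule inj_onI)
      fix p q assume p: "p \<in> ?B" and q: "q \<in> ?B" and eq: "?f p = ?f q"
      obtain i s u where pe: "p = (i, s, u)" by (cases p)
      obtain j t w where qe: "q = (j, t, w)" by (cases q)
      have b: "i \<in> {1..n}" "j \<in> {1..n}" "s \<in> {1, m - 1}" "t \<in> {1, m - 1}" "u \<in> A" "w \<in> A"
        "?v i s u \<notin> A" "?v j t w \<notin> A"
        using p q unfolding pe qe by auto
      have "{u, ?v i s u} = {w, ?v j t w}" using eq unfolding pe qe by simp
      then have uw: "u = w" and vv: "?v i s u = ?v j t u"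
        using b by (auto simp: doubleton_eq_iff)
      have st: "s < m" "t < m" "s > 0" using b m by auto
      have ui: "u i < m" using less b by blast
      have ne: "(u i + s) mod m \<noteq> u i"
        using st ui by (auto simp: mod_add_eq_if split: if_splits)
      have ij: "i = j"
      proof (rule ccontr)
        assume "i \<noteq> j"
        then show False using fun_cong[OF vv, of i] ne by simp
      qed
      have "(u i + s) mod m = (u i + t) mod m"
        using fun_cong[OF vv, of i] ij by simp
      then have "s = t"
        using st ui by (auto simp: mod_add_eq_if split: if_splits)
      then show "p = q" using uw ij pe qe by simp
    qed
    show "?f ` ?B \<subseteq> {f \<in> edges ?G. \<exists>!x. x \<in> f \<and> x \<in> A}"
    proof clarify
      fix i s u assume i: "i \<in> {1..n}" and s: "s \<in> {1, m - 1}" and u: "u \<in> A" and v: "?v i s u \<notin> A"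
      have ui: "u i < m" using less i u by blast
      have uP: "u \<in> {1..n} \<rightarrow>\<^sub>E {0..<m}" using u V by blast
      have vP: "?v i s u \<in> {1..n} \<rightarrow>\<^sub>E {0..<m}"
        using uP i m by (auto simp: PiE_iff extensional_def)
      have "{u i, (u i + s) mod m} \<in> edges (cycle_graph m)"
      proof (cases "s = 1")
        case True
        then show ?thesis using ui by (auto simp: cycle_graph_def)
      next
        case False
        then have "s = m - 1" using s by simp
        \<comment> \<open>\<open>cycle_graph\<close> lists each edge from its lower end cyclically;
          for a backward step that end is the new point.\<close>
        then have "((u i + s) mod m + 1) mod m = u i"
          using ui by (simp add: mod_simps)
        then show ?thesis using ui m
          by (auto simp: cycle_graph_def insert_commute intro!: exI[of _ "(u i + s) mod m"])
      qed
      then have "\<exists>j\<in>{1..n}. {u j, ?v i s u j} \<in> edges (cycle_graph m) \<and>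
          (\<forall>l\<in>{1..n} - {j}. u l = ?v i s u l)"
        using i by (intro bexI[of _ i]) simp_all
      moreover have "vertices (cycle_graph m) = {0..<m}"
        by (simp add: cycle_graph_def)
      ultimately have "{u, ?v i s u} \<in> edges ?G"
        unfolding graph_power_def ugraph.simps mem_Collect_eq using uP vP
        by (intro exI[of _ u] exI[of _ "?v i s u"]) (simp only: simp_thms)
      moreover have "\<exists>!x. x \<in> {u, ?v i s u} \<and> x \<in> A"
        using u v by auto
      ultimately show "{u, ?v i s u} \<in> edges ?G \<and> (\<exists>!x. x \<in> {u, ?v i s u} \<and> x \<in> A)" ..
    qed
    have "edges ?G \<subseteq> Pow ({1..n} \<rightarrow>\<^sub>E {0..<m})"
      by (auto simp: graph_power_def cycle_graph_def)
    then have "finite (edges ?G)"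
      by (rule finite_subset) (auto intro: finite_PiE)
    then show "finite {f \<in> edges ?G. \<exists>!x. x \<in> f \<and> x \<in> A}" by simp
  qed
  finally show ?thesis by (simp add: edge_boundary_size_def)
qed

section \<open>Tangent lines and the choice of \<open>c\<close>\<close>

text \<open>At \<open>k = m\<close> the right-hand side is \<open>exp c * (1 - c) / m \<le> 0\<close>; this is where \<open>c \<ge> 1\<close> is needed.\<close>

lemma inverse_fibre_tangent:
  fixes k m :: nat and c :: real
  assumes "0 < k" "k \<le> m" "1 \<le> c"
  shows "exp c * (1 - c + ln (real m) - ln (real k)) / real m \<le> (if k < m then 1 / real k else 0)"
proof (cases "k < m")
  case True
  let ?l = "ln (real m) - ln (real k)"
  have m: "real m > 0" using True by simp
  \<comment> \<open>The tangent to \<open>exp\<close> at \<open>c\<close>, evaluated at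
    \<open>ln (m / k)\<close>.\<close>
  have "exp c * (1 - c + ?l) \<le> exp c * exp (?l - c)"
    using exp_ge_add_one_self[of "?l - c"] by (intro mult_left_mono) (auto simp: algebra_simps)
  also have "\<dots> = exp ?l" by (simp add: exp_add[symmetric])
  also have "\<dots> = real m / real k" using assms m by (simp add: exp_diff)
  finally have "exp c * (1 - c + ?l) / real m \<le> real m / real k / real m"
    by (rule divide_right_mono) simp
  then show ?thesis using True m by (simp add: algebra_simps)
next
  case False
  then have "k = m" using assms by simp
  then show ?thesis using assms by (simp add: divide_nonpos_nonneg mult_nonneg_nonpos)
qed

text \<open>The tangent bound is linear in \<open>ln k\<close>, so after summation Han's inequality
  controls it.\<close>

lemma edge_boundary_size_tangent:
  fixes c :: real
  assumes m: "m \<ge> 3" and A: "A \<subseteq> vertices (graph_power (cycle_graph m) n)" and c: "1 \<le> c"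
  shows "2 * real (card A) / real m *
      (exp c * (real n * (1 - c) + (real n * ln (real m) - ln (real (card A)))))
    \<le> real (edge_boundary_size (graph_power (cycle_graph m) n) A)"
proof -
  let ?k = "\<lambda>i x. card (fibre A i x)"
  let ?a = "real (card A)"
  have V: "A \<subseteq> {1..n} \<rightarrow>\<^sub>E {0..<m}"
    using A by (simp add: graph_power_def cycle_graph_def)
  then have finA: "finite A"
    by (rule finite_subset) (auto intro: finite_PiE)
  have bnd: "y i < m" if "i \<in> {1..n}" "y \<in> A" for y i
    using that V by fastforce
  have kle: "?k i x \<le> m" if "i \<in> {1..n}" for i x
  proof -
    have "inj_on (\<lambda>y. y i) (fibre A i x)"
      by (rule inj_onI, rule ext) (metis (mono_tags, lifting) fibre_def mem_Collect_eq)
    moreover have "(\<lambda>y. y i) ` fibre A i x \<subseteq> {..<m}"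
      using bnd[OF that] by (auto simp: fibre_def)
    ultimately have "?k i x \<le> card {..<m}" by (rule card_inj_on_le) simp
    then show ?thesis by simp
  qed
  have "?a * (real n * (1 - c) + (real n * ln (real m) - ln ?a))
      \<le> ?a * (real n * (1 - c + ln (real m))) - (\<Sum>x\<in>A. \<Sum>i\<in>{1..n}. ln (real (?k i x)))"
    using sum_ln_card_fibre_le[of "{1..n}" A] finA by (simp add: algebra_simps)
  also have "\<dots> = (\<Sum>x\<in>A. \<Sum>i\<in>{1..n}. 1 - c + ln (real m) - ln (real (?k i x)))"
    by (simp add: sum_subtractf sum.distrib algebra_simps)
  finally have "exp c / real m * (?a * (real n * (1 - c) + (real n * ln (real m) - ln ?a)))
      \<le> exp c / real m * (\<Sum>x\<in>A. \<Sum>i\<in>{1..n}. 1 - c + ln (real m) - ln (real (?k i x)))"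
    by (rule mult_left_mono) simp
  also have "\<dots> = (\<Sum>x\<in>A. \<Sum>i\<in>{1..n}. exp c * (1 - c + ln (real m) - ln (real (?k i x))) / real m)"
    by (simp add: sum_distrib_left)
  also have "\<dots> \<le> (\<Sum>x\<in>A. \<Sum>i\<in>{1..n}. if ?k i x < m then 1 / real (?k i x) else 0)"
    by (intro sum_mono inverse_fibre_tangent card_fibre_pos finA kle c)
  also have "\<dots> = (\<Sum>i\<in>{1..n}. \<Sum>x\<in>A. if ?k i x < m then 1 / real (?k i x) else 0)"
    by (rule sum.swap)
  finally have "2 * (exp c / real m * (?a * (real n * (1 - c) + (real n * ln (real m) - ln ?a))))
      \<le> 2 * (\<Sum>i\<in>{1..n}. \<Sum>x\<in>A. if ?k i x < m then 1 / real (?k i x) else 0)"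
    by simp
  \<comment> \<open>The factor 2 counts the two directions: \<open>1\<close> and
    \<open>m - 1\<close> differ because \<open>m \<ge> 3\<close>.\<close>
  also have "\<dots> = (\<Sum>i\<in>{1..n}. \<Sum>s\<in>{1, m - 1}. \<Sum>x\<in>A. if ?k i x < m then 1 / real (?k i x) else 0)"
    using m by (simp add: sum_distrib_left)
  also have "\<dots> \<le> (\<Sum>i\<in>{1..n}. \<Sum>s\<in>{1, m - 1}. real (card {u\<in>A. u(i := (u i + s) mod m) \<notin> A}))"
    by (intro sum_mono sum_inverse_card_fibre_le_exits finA bnd)
  also have "\<dots> = real (\<Sum>i\<in>{1..n}. \<Sum>s\<in>{1, m - 1}. card {u\<in>A. u(i := (u i + s) mod m) \<notin> A})"
    by simp
  also have "\<dots> \<le> real (edge_boundary_size (graph_power (cycle_graph m) n) A)"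
    using sum_card_exits_le_edge_boundary_size[OF m A] by (rule of_nat_mono)
  finally show ?thesis by (simp add: algebra_simps)
qed

text \<open>Over \<open>c \<ge> 1\<close>, the factor \<open>exp c * (n * (1 - c) + L)\<close> is
  largest at \<open>c = L / n\<close> if \<open>L \<ge> n\<close> and at \<open>c = 1\<close>
  otherwise. The threshold \<open>(m / e)^n\<close> for the size of \<open>A\<close> corresponds to
  \<open>L = n\<close>.\<close>

theorem mainTheorem9:
  fixes m n :: nat and A :: "(nat \<Rightarrow> nat) set"
  assumes "m \<ge> 3" and "n \<ge> 1"
    and "A \<subseteq> vertices (graph_power (cycle_graph m) n)" and "A \<noteq> {}"
  shows "(real (card A) \<le> (real m / exp 1) ^ n \<longrightarrow>
            real (edge_boundary_size (graph_power (cycle_graph m) n) A)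
              \<ge> 2 * real n * real (card A) powr (1 - 1 / real n)) \<and>
         (real (card A) \<ge> (real m / exp 1) ^ n \<longrightarrow>
            real (edge_boundary_size (graph_power (cycle_graph m) n) A)
              \<ge> real (card A) / real m * (2 * exp 1 * ln (real m ^ n / real (card A))))"
proof -
  let ?e = "real (edge_boundary_size (graph_power (cycle_graph m) n) A)"
  define a where "a = real (card A)"
  define L where "L = real n * ln (real m) - ln a"
  have "finite A"
    using assms(3) by (rule finite_subset) (auto simp: graph_power_def cycle_graph_def intro: finite_PiE)
  then have a: "a > 0" using assms(4) by (simp add: a_def card_gt_0_iff)
  have m: "real m > 0" and n: "real n > 0" using assms by auto
  have bound: "2 * a / real m * (exp c * (real n * (1 - c) + L)) \<le> ?e" if "1 \<le> c" for c
    using edge_boundary_size_tangent[OF assms(1,3) that] by (simp add: a_def L_def)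
  have small: "2 * real n * a powr (1 - 1 / real n) \<le> ?e" if le: "a \<le> (real m / exp 1) ^ n"
  proof -
    have "ln a \<le> ln ((real m / exp 1) ^ n)" using le a m by simp
    also have "\<dots> = real n * (ln (real m) - 1)" using m by (simp add: ln_realpow ln_div)
    \<comment> \<open>The size bound on \<open>A\<close> makes \<open>c = L / n\<close>
      admissible.\<close>
    finally have "1 \<le> L / real n" using n by (simp add: L_def field_simps)
    moreover have "real n * (1 - L / real n) + L = real n" using n by (simp add: field_simps)
    ultimately have "2 * a / real m * (exp (L / real n) * real n) \<le> ?e"
      using bound[of "L / real n"] by simp
    moreover have "L / real n = ln (real m) - ln a / real n"
      using n by (simp add: L_def field_simps)
    then have "exp (L / real n) = real m * a powr (- (1 / real n))"
      unfolding \<open>L / real n = _\<close> using m a by (simp add: exp_diff powr_def exp_minus field_simps)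
    moreover have "a powr (1 - 1 / real n) = a * a powr (- (1 / real n))"
      using a by (simp add: powr_diff powr_minus field_simps)
    ultimately show ?thesis using m by (simp add: field_simps)
  qed
  have "ln (real m ^ n / a) = L" using m a by (simp add: L_def ln_div ln_realpow)
  with bound[of 1] have "a / real m * (2 * exp 1 * ln (real m ^ n / a)) \<le> ?e"
    by (simp add: algebra_simps)
  with small show ?thesis unfolding a_def by blast
qed

end
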